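(* Consider the control system $\dot x=f(x,u)$ with $f:\mathbb{R}^n\times\mathbb{R}^m\to\mathbb{R}^n$ locally Lipschitz, and let $\mathcal{C}\subset\mathbb{R}^n$ be a set for which there exists a continuously differentiable $h_0:\mathbb{R}^n\to\mathbb{R}$ with $\mathcal{C}=\{x:h_0(x)\ge0\}$, $\partial\mathcal{C}=\{x:h_0(x)=0\}$, $\mathrm{Int}(\mathcal{C})=\{x:h_0(x)>0\}$, and $\mathbf{0}_n\in\mathrm{Int}(\mathcal{C})$. If the set $\mathbb{R}^n\setminus\mathcal{C}$ has a bounded connected component, then there does not exist a strictly compatible CLF-CBF pair on $\mathcal{C}$.
   Context: $\alpha:\mathbb{R}\to\mathbb{R}$ is of extended class $\mathcal{K}_\infty$ if it is continuous, strictly increasing, $\alpha(0)=0$, and $\lim_{r\to\pm\infty}\alpha(r)=\pm\infty$. A function $V$ is positive definite if $V(0)=0$ and $V(x)>0$ for $x\ne0$; it is proper in $\Gamma$ if $\{x\in\Gamma:V(x)\le c\}$ is compact for every $c\ge0$. CLF. Given $\Gamma\subseteq\mathbb{R}^n$ with $\mathbf{0}_n\in\Gamma$, a continuously differentiable $V:\Gamma\to\mathbb{R}$ is a control Lyapunov function (CLF) on $\Gamma$ if it is proper in $\Gamma$, positive definite, and there exists a positive definite $W:\Gamma\to\mathbb{R}$ such that for each $x\in\Gamma\setminus\{0\}$ there exists $u\in\mathbb{R}^m$ with (CLF inequality) $\nabla V(x)^Tf(x,u)\le-W(x)$. CBF. A continuously differentiable $h:\mathbb{R}^n\to\mathbb{R}$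 with $\mathcal{C}=\{h\ge0\}$, $\partial\mathcal{C}=\{h=0\}$, $\mathrm{Int}(\mathcal{C})=\{h>0\}\neq\emptyset$ is a control barrier function (CBF) of $\mathcal{C}$ if there is an extended class $\mathcal{K}_\infty$ function $\alpha$ such that for all $x\in\mathcal{C}$ there is $u\in\mathbb{R}^m$ with (CBF inequality) $\nabla h(x)^Tf(x,u)+\alpha(h(x))\ge0$. Strict compatibility. Let $\Gamma\subseteq\mathbb{R}^n$ be open, $\mathcal{C}\subset\Gamma$ closed, $V$ a CLF on $\Gamma$ (with associated $W$) and $h$ a CBF of $\mathcal{C}$ (with associated $\alpha$). $V,h$ are a strictly compatible CLF-CBF pair on (in) $\mathcal{C}$ if for every $x\in\mathcal{C}\setminus\{0\}$ there exists $u\in\mathbb{R}^m$ satisfying both the CLF inequality and the CBF inequality strictly and simultaneously (with $W$ and $\alpha$ not depending on $x$). *)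

theory Defs
  imports "HOL-Analysis.Analysis"
begin

definition gradient :: "('a::real_inner \<Rightarrow> real) \<Rightarrow> 'a \<Rightarrow> 'a" where
  "gradient g x = (THE D. GDERIV g x :> D)"

lemma gradient_eq:
  assumes "GDERIV g x :> D"
  shows "gradient g x = D"
proof -
  have "E = D" if "GDERIV g x :> E" for E
  proof -
    have "(\<lambda>h. inner h E) = (\<lambda>h. inner h D)"
      using that assms has_derivative_unique unfolding gderiv_def by blast
    then have "inner h E = inner h D" for h
      by metis
    then show ?thesis
      by (metis inner_commute vector_eq_rdot)
  qed
  with assms show ?thesis
    unfolding gradient_def by (intro the_equality)
qed

(* Two-sided differentiability: meant for open S, where it depends only on the
   values of g on S.  Functions on S are total functions with unspecified values
   outside S. *)
definition continuously_differentiable_on :: "('a::real_inner \<Rightarrow> real) \<Rightarrow> 'a set \<Rightarrow> bool" where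
  "continuously_differentiable_on g S \<longleftrightarrow>
     (\<forall>x\<in>S. g differentiable (at x)) \<and> continuous_on S (gradient g)"

definition locally_lipschitz_on :: "('a::metric_space \<Rightarrow> 'b::metric_space) \<Rightarrow> 'a set \<Rightarrow> bool" where
  "locally_lipschitz_on g S \<longleftrightarrow>
     (\<forall>z\<in>S. \<exists>r>0. \<exists>L. L-lipschitz_on (cball z r \<inter> S) g)"

definition extended_class_K_inf :: "(real \<Rightarrow> real) \<Rightarrow> bool" where
  "extended_class_K_inf \<alpha> \<longleftrightarrow>
     continuous_on UNIV \<alpha> \<and> strict_mono \<alpha> \<and> \<alpha> 0 = 0 \<and>
     filterlim \<alpha> at_top at_top \<and> filterlim \<alpha> at_bot at_bot"

definition positive_definite_on :: "('a::zero \<Rightarrow> real) \<Rightarrow> 'a set \<Rightarrow> bool" where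
  "positive_definite_on V \<Gamma> \<longleftrightarrow> V 0 = 0 \<and> (\<forall>x\<in>\<Gamma> - {0}. V x > 0)"

definition proper_in :: "('a::topological_space \<Rightarrow> real) \<Rightarrow> 'a set \<Rightarrow> bool" where
  "proper_in V \<Gamma> \<longleftrightarrow> (\<forall>c\<ge>0. compact {x \<in> \<Gamma>. V x \<le> c})"

definition clf_with ::
  "((real^'n) \<times> (real^'m) \<Rightarrow> real^'n) \<Rightarrow> (real^'n) set \<Rightarrow> (real^'n \<Rightarrow> real) \<Rightarrow> (real^'n \<Rightarrow> real) \<Rightarrow> bool" where
  "clf_with f \<Gamma> V W \<longleftrightarrow>
     0 \<in> \<Gamma> \<and> continuously_differentiable_on V \<Gamma> \<and> proper_in V \<Gamma> \<and>
     positive_definite_on V \<Gamma> \<and> positive_definite_on W \<Gamma> \<and>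
     (\<forall>x\<in>\<Gamma> - {0}. \<exists>u. gradient V x \<bullet> f (x, u) \<le> - W x)"

definition zero_superlevel_set :: "(real^'n \<Rightarrow> real) \<Rightarrow> (real^'n) set \<Rightarrow> bool" where
  "zero_superlevel_set h C \<longleftrightarrow>
     continuously_differentiable_on h UNIV \<and>
     C = {x. h x \<ge> 0} \<and> frontier C = {x. h x = 0} \<and> interior C = {x. h x > 0}"

definition cbf_with ::
  "((real^'n) \<times> (real^'m) \<Rightarrow> real^'n) \<Rightarrow> (real^'n) set \<Rightarrow> (real^'n \<Rightarrow> real) \<Rightarrow> (real \<Rightarrow> real) \<Rightarrow> bool" where
  "cbf_with f C h \<alpha> \<longleftrightarrow>
     zero_superlevel_set h C \<and> interior C \<noteq> {} \<and> extended_class_K_inf \<alpha> \<and>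
     (\<forall>x\<in>C. \<exists>u. gradient h x \<bullet> f (x, u) + \<alpha> (h x) \<ge> 0)"

definition strictly_compatible ::
  "((real^'n) \<times> (real^'m) \<Rightarrow> real^'n) \<Rightarrow> (real^'n) set \<Rightarrow> (real^'n) set \<Rightarrow>
   (real^'n \<Rightarrow> real) \<Rightarrow> (real^'n \<Rightarrow> real) \<Rightarrow> bool" where
  "strictly_compatible f \<Gamma> C V h \<longleftrightarrow>
     open \<Gamma> \<and> closed C \<and> C \<subseteq> \<Gamma> \<and>
     (\<exists>W \<alpha>. clf_with f \<Gamma> V W \<and> cbf_with f C h \<alpha> \<and>
       (\<forall>x\<in>C - {0}. \<exists>u. gradient V x \<bullet> f (x, u) < - W x \<and>
                        gradient h x \<bullet> f (x, u) + \<alpha> (h x) > 0))"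

end

theory Submission
  imports Defs
begin

text \<open>
  A strictly compatible pair would allow \<open>C\<close> to be pushed, inside itself, into a small ball around the
  origin, and a closed set whose complement has a bounded component \<open>K\<close> does not admit this: for
  \<open>a \<in> K\<close> the map \<open>x \<mapsto> (x - a) / norm (x - a)\<close> is essential on \<open>frontier K \<subseteq> C\<close>
  (\<open>inclusion_of_frontier_essential\<close>).

  The push comes from an explicit vector field, so that no controls have to be selected
  continuously. Write \<open>p\<close> and \<open>q\<close> for the gradients of \<open>V\<close> and \<open>h\<close>. Strict compatibility forces \<open>p \<noteq> 0\<close> on
  \<open>C - {0}\<close>, and on the boundary, where \<open>h = 0\<close>, it forces \<open>q \<noteq> 0\<close> and prevents \<open>p\<close> and \<open>q\<close> from being
  positive multiples of each other. Hence the continuous field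
  \<open>norm p *\<^sub>R q - (norm q + h) *\<^sub>R p\<close> strictly decreases \<open>V\<close> on \<open>C - {0}\<close> and strictly
  increases \<open>h\<close> on the boundary (\<open>steering_decreases\<close> and \<open>steering_increases\<close>).

  Instead of the flow of this field, which is merely continuous, the proof iterates Euler steps.
  Sublevel sets of \<open>V\<close> in \<open>C\<close> are compact, so a single step size works for all their points
  (\<open>euler_step_uniform\<close>): each step stays in \<open>C\<close>, and lowers \<open>V\<close> by a fixed amount until a
  prescribed small level is reached. The straight segments traced by the steps lie in \<open>C\<close>
  and concatenate to the required homotopy (\<open>push_into_sublevel\<close>).
\<close>

section \<open>Euler steps along a continuous vector field\<close>

lemma euler_step_near:
  fixes X :: "'a::real_normed_vector \<Rightarrow> 'a"
  assumes "isCont X z" "open U" "z \<in> U"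
  shows "\<exists>e>0. \<forall>x\<in>ball z e. \<forall>t\<in>{0..e}. x + t *\<^sub>R X x \<in> U"
proof -
  obtain r where r: "r > 0" "ball z r \<subseteq> U"
    using assms open_contains_ball by blast
  define B where "B = norm (X z) + 1"
  have B: "B > 0" unfolding B_def by (simp add: add_nonneg_pos)
  obtain \<delta> where \<delta>: "\<delta> > 0" "\<And>x. dist x z < \<delta> \<Longrightarrow> dist (X x) (X z) < 1"
    using assms(1) unfolding continuous_at_eps_delta by (meson zero_less_one)
  define e where "e = min \<delta> (min (r/2) (r/(2*B)))"
  have e: "e > 0" "e \<le> \<delta>" "e \<le> r/2" "e \<le> r/(2*B)"
    using \<delta>(1) r(1) B by (auto simp: e_def)
  then have eB: "e * B \<le> r/2" using B by (simp add: field_simps)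
  have "x + t *\<^sub>R X x \<in> U" if x: "x \<in> ball z e" and t: "t \<in> {0..e}" for x t
  proof -
    have "dist (X x) (X z) < 1" using x e by (intro \<delta>) (auto simp: dist_commute)
    then have nX: "norm (X x) \<le> B"
      unfolding B_def dist_norm by norm
    have "norm (t *\<^sub>R X x) \<le> e * B"
      using t nX by (auto intro!: mult_mono)
    then have "norm (t *\<^sub>R X x) \<le> r/2" using eB by linarith
    moreover have "norm (z - x) < r/2" using x e by (auto simp: dist_norm)
    ultimately have "norm (z - (x + t *\<^sub>R X x)) < r"
      using norm_triangle_ineq4[of "z - x" "t *\<^sub>R X x"] by (simp add: diff_diff_eq)
    then show ?thesis using r(2) by (auto simp: dist_norm subset_iff)
  qed
  with e(1) show ?thesis by blast
qed

text \<open>The point of this form is that the rate and the step bound hold on a whole neighbourhood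
  of the base point. By the mean value theorem the change of \<open>g\<close> is governed by its gradient at
  some other nearby point, so joint continuity of \<open>(y, x) \<mapsto> G y \<bullet> X x\<close> suffices.\<close>

lemma euler_step_decrease:
  fixes g :: "'a::real_inner \<Rightarrow> real"
  assumes U: "open U" and g: "\<And>x. x \<in> U \<Longrightarrow> GDERIV g x :> G x"
    and contG: "continuous_on U G" and contX: "continuous_on U X"
    and z: "z \<in> U" and lt: "G z \<bullet> X z < - \<eta>"
  shows "\<exists>e>0. \<forall>x\<in>ball z e. \<forall>t\<in>{0..e}. g (x + t *\<^sub>R X x) \<le> g x - t * \<eta>"
proof -
  let ?P = "(\<lambda>y. G (fst y) \<bullet> X (snd y)) -` {..<-\<eta>} \<inter> (U \<times> U)"
  have "continuous_on (U \<times> U) (\<lambda>y. G (fst y) \<bullet> X (snd y))"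
    by (intro continuous_intros continuous_on_compose2[OF contG] continuous_on_compose2[OF contX]) auto
  then have "open ?P"
    by (subst (asm) continuous_on_open_vimage) (auto intro: open_Times U)
  moreover have "(z, z) \<in> ?P" using z lt by simp
  ultimately obtain A B where AB: "open A" "open B" "(z, z) \<in> A \<times> B" "A \<times> B \<subseteq> ?P"
    by (rule open_prod_elim)
  then have "open (A \<inter> B)" "z \<in> A \<inter> B" by auto
  then obtain r where r: "r > 0" "ball z r \<subseteq> A \<inter> B"
    using open_contains_ball by blast
  have rU: "y \<in> U" "G y \<bullet> X x < - \<eta>" if "y \<in> ball z r" "x \<in> ball z r" for x y
  proof -
    have "(y, x) \<in> ?P" using that r AB by blast
    then show "y \<in> U" "G y \<bullet> X x < - \<eta>" by auto
  qed
  have "isCont X z"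
    using contX U z by (simp add: continuous_on_eq_continuous_at)
  then obtain e where e: "e > 0" "\<And>x t. x \<in> ball z e \<Longrightarrow> t \<in> {0..e} \<Longrightarrow> x + t *\<^sub>R X x \<in> ball z r"
    using euler_step_near[where X=X and U="ball z r"] r(1) by (metis centre_in_ball open_ball)
  have "g (x + t *\<^sub>R X x) \<le> g x - t * \<eta>" if x: "x \<in> ball z e" and t: "t \<in> {0..e}" for x t
  proof -
    have seg: "x + s *\<^sub>R X x \<in> ball z r" if "0 \<le> s" "s \<le> t" for s
      using e(2)[OF x, of s] that t by auto
    have xr: "x \<in> ball z r" using seg[of 0] t by simp
    have "\<exists>s\<in>{0..t}. g (x + t *\<^sub>R X x) - g (x + 0 *\<^sub>R X x) = (t - 0) * (G (x + s *\<^sub>R X x) \<bullet> X x)"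
    proof (rule mvt_very_simple[where f="\<lambda>s. g (x + s *\<^sub>R X x)"
          and f'="\<lambda>s v. v * (G (x + s *\<^sub>R X x) \<bullet> X x)"])
      show "0 \<le> t" using t by simp
      fix s :: real assume s: "0 \<le> s" "s \<le> t"
      have "(g has_derivative (\<lambda>v. v \<bullet> G (x + s *\<^sub>R X x))) (at (x + s *\<^sub>R X x))"
        using g rU(1)[OF seg[OF s] xr] unfolding gderiv_def by blast
      moreover have "((\<lambda>s. x + s *\<^sub>R X x) has_derivative (\<lambda>v. v *\<^sub>R X x)) (at s within {0..t})"
        by (auto intro!: derivative_eq_intros)
      ultimately have "((\<lambda>s. g (x + s *\<^sub>R X x)) has_derivative
          (\<lambda>v. (v *\<^sub>R X x) \<bullet> G (x + s *\<^sub>R X x))) (at s within {0..t})"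
        by (rule has_derivative_compose[rotated])
      then show "((\<lambda>s. g (x + s *\<^sub>R X x)) has_derivative
          (\<lambda>v. v * (G (x + s *\<^sub>R X x) \<bullet> X x))) (at s within {0..t})"
        by (simp add: inner_commute)
    qed
    then obtain s where s: "s \<in> {0..t}"
      "g (x + t *\<^sub>R X x) - g x = t * (G (x + s *\<^sub>R X x) \<bullet> X x)" by auto
    have "G (x + s *\<^sub>R X x) \<bullet> X x < - \<eta>"
      using s by (intro rU(2) seg xr) auto
    then have "t * (G (x + s *\<^sub>R X x) \<bullet> X x) \<le> t * (- \<eta>)"
      using t by (intro mult_left_mono) auto
    then show ?thesis using s(2) by simp
  qed
  with e(1) show ?thesis by blast
qed

lemma compact_uniform_parameter:
  fixes M :: "'a::metric_space set" and Q :: "real \<Rightarrow> 'a \<Rightarrow> bool"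
  assumes "compact M"
    and loc: "\<And>z. z \<in> M \<Longrightarrow> \<exists>e>0. \<forall>x\<in>ball z e \<inter> M. Q e x"
    and mono: "\<And>e e' x. x \<in> M \<Longrightarrow> 0 < e' \<Longrightarrow> e' \<le> e \<Longrightarrow> Q e x \<Longrightarrow> Q e' x"
  shows "\<exists>e>0. \<forall>x\<in>M. Q e x"
proof -
  obtain r where r: "\<And>z. z \<in> M \<Longrightarrow> r z > 0 \<and> (\<forall>x\<in>ball z (r z) \<inter> M. Q (r z) x)"
    using loc by metis
  have "M \<subseteq> (\<Union>z\<in>M. ball z (r z))" using r by force
  then obtain D where D: "D \<subseteq> M" "finite D" "M \<subseteq> (\<Union>z\<in>D. ball z (r z))"
    using compactE_image[OF assms(1), of M "\<lambda>z. ball z (r z)"] by blast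
  define e where "e = Min (insert 1 (r ` D))"
  have e: "e > 0" "\<And>z. z \<in> D \<Longrightarrow> e \<le> r z"
    using D r by (auto simp: e_def)
  have "Q e x" if x: "x \<in> M" for x
  proof -
    obtain z where "z \<in> D" "x \<in> ball z (r z)" using D(3) x by blast
    then show ?thesis using r[of z] D(1) x mono[OF x e(1) e(2)] by blast
  qed
  with e(1) show ?thesis by blast
qed

text \<open>One number \<open>e\<close> serves both as the bound on the step size and as the rate of decrease of \<open>V\<close>;
  the resulting condition weakens as \<open>e\<close> shrinks, which is what the passage from local to uniform
  needs. The level \<open>d\<close> caps the conclusion because below it \<open>X\<close> need not decrease \<open>V\<close>.\<close>

lemma euler_step_uniform:
  fixes V h :: "'a::real_inner \<Rightarrow> real"
  assumes U: "open U"
    and V: "\<And>x. x \<in> U \<Longrightarrow> GDERIV V x :> p x" and p: "continuous_on U p"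
    and h: "\<And>x. x \<in> U \<Longrightarrow> GDERIV h x :> q x" and q: "continuous_on U q"
    and X: "continuous_on U X"
    and M: "compact M" "M \<subseteq> U" "\<And>x. x \<in> M \<Longrightarrow> 0 \<le> h x"
    and decr: "\<And>x. x \<in> M \<Longrightarrow> d \<le> V x \<Longrightarrow> p x \<bullet> X x < 0"
    and incr: "\<And>x. x \<in> M \<Longrightarrow> h x = 0 \<Longrightarrow> 0 < q x \<bullet> X x"
  shows "\<exists>e>0. \<forall>x\<in>M. \<forall>t\<in>{0..e}. 0 \<le> h (x + t *\<^sub>R X x) \<and> V (x + t *\<^sub>R X x) \<le> max d (V x - t * e)"
proof (rule compact_uniform_parameter[OF M(1)])
  have contV: "continuous_on U V" and conth: "continuous_on U h"
    using V h U unfolding gderiv_def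
    by (meson continuous_at_imp_continuous_on has_derivative_continuous)+
  fix z assume z: "z \<in> M"
  then have zU: "z \<in> U" using M by blast
  have Xz: "isCont X z" using X U zU by (simp add: continuous_on_eq_continuous_at)
  have "\<exists>e>0. \<forall>x\<in>ball z e \<inter> M. \<forall>t\<in>{0..e}. 0 \<le> h (x + t *\<^sub>R X x)"
  proof (cases "h z = 0")
    case False
    have op: "open (h -` {0<..} \<inter> U)"
      using conth U by (subst (asm) continuous_on_open_vimage) auto
    have zin: "z \<in> h -` {0<..} \<inter> U"
      using False M(3)[OF z] zU by simp
    from euler_step_near[OF Xz op zin] show ?thesis by fastforce
  next
    case True
    have "\<exists>e>0. \<forall>x\<in>ball z e. \<forall>t\<in>{0..e}. - h (x + t *\<^sub>R X x) \<le> - h x - t * 0"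
    proof (rule euler_step_decrease[OF U _ _ X zU])
      show "GDERIV (\<lambda>x. - h x) x :> - q x" if "x \<in> U" for x
        using h[OF that] by (rule GDERIV_minus)
      show "continuous_on U (\<lambda>x. - q x)" using q by (intro continuous_intros)
      show "- q z \<bullet> X z < - 0" using incr[OF z True] by simp
    qed
    then show ?thesis using M(3) by fastforce
  qed
  then obtain e1 where e1: "e1 > 0"
    "\<And>x t. x \<in> ball z e1 \<inter> M \<Longrightarrow> t \<in> {0..e1} \<Longrightarrow> 0 \<le> h (x + t *\<^sub>R X x)" by blast
  have "\<exists>e>0. \<forall>x\<in>ball z e. \<forall>t\<in>{0..e}. V (x + t *\<^sub>R X x) \<le> max d (V x - t * e)"
  proof (cases "V z < d")
    case True
    have op: "open (V -` {..<d} \<inter> U)"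
      using contV U by (subst (asm) continuous_on_open_vimage) auto
    have zin: "z \<in> V -` {..<d} \<inter> U" using True zU by simp
    from euler_step_near[OF Xz op zin] show ?thesis by fastforce
  next
    case False
    define \<eta> where "\<eta> = - (p z \<bullet> X z) / 2"
    have \<eta>: "\<eta> > 0" "p z \<bullet> X z < - \<eta>"
      using decr[OF z] False by (auto simp: \<eta>_def)
    obtain e where e: "e > 0"
      "\<And>x t. x \<in> ball z e \<Longrightarrow> t \<in> {0..e} \<Longrightarrow> V (x + t *\<^sub>R X x) \<le> V x - t * \<eta>"
      using euler_step_decrease[OF U V p X zU \<eta>(2)] by blast
    show ?thesis
    proof (intro exI[of _ "min e \<eta>"] conjI ballI)
      show "0 < min e \<eta>" using e \<eta> by simp
      fix x t assume "x \<in> ball z (min e \<eta>)" and t: "t \<in> {0..min e \<eta>}"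
      then have "V (x + t *\<^sub>R X x) \<le> V x - t * \<eta>" by (intro e) auto
      moreover have "t * min e \<eta> \<le> t * \<eta>" using t by (intro mult_left_mono) auto
      ultimately show "V (x + t *\<^sub>R X x) \<le> max d (V x - t * min e \<eta>)" by linarith
    qed
  qed
  then obtain e2 where e2: "e2 > 0"
    "\<And>x t. x \<in> ball z e2 \<Longrightarrow> t \<in> {0..e2} \<Longrightarrow> V (x + t *\<^sub>R X x) \<le> max d (V x - t * e2)" by blast
  show "\<exists>e>0. \<forall>x\<in>ball z e \<inter> M. \<forall>t\<in>{0..e}. 0 \<le> h (x + t *\<^sub>R X x) \<and> V (x + t *\<^sub>R X x) \<le> max d (V x - t * e)"
  proof (intro exI[of _ "min e1 e2"] conjI ballI)
    show "0 < min e1 e2" using e1 e2 by simp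
    fix x t assume x: "x \<in> ball z (min e1 e2) \<inter> M" and t: "t \<in> {0..min e1 e2}"
    show "0 \<le> h (x + t *\<^sub>R X x)" using x t by (intro e1) auto
    have "V (x + t *\<^sub>R X x) \<le> max d (V x - t * e2)" using x t by (intro e2) auto
    moreover have "t * min e1 e2 \<le> t * e2" using t by (intro mult_left_mono) auto
    ultimately show "V (x + t *\<^sub>R X x) \<le> max d (V x - t * min e1 e2)" by linarith
  qed
next
  fix e e' :: real and x
  assume e: "0 < e'" "e' \<le> e"
    and Q: "\<forall>t\<in>{0..e}. 0 \<le> h (x + t *\<^sub>R X x) \<and> V (x + t *\<^sub>R X x) \<le> max d (V x - t * e)"
  show "\<forall>t\<in>{0..e'}. 0 \<le> h (x + t *\<^sub>R X x) \<and> V (x + t *\<^sub>R X x) \<le> max d (V x - t * e')"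
  proof
    fix t assume t: "t \<in> {0..e'}"
    have "t * e' \<le> t * e" using t e by (intro mult_left_mono) auto
    moreover have "0 \<le> h (x + t *\<^sub>R X x) \<and> V (x + t *\<^sub>R X x) \<le> max d (V x - t * e)"
      using Q t e by auto
    ultimately show "0 \<le> h (x + t *\<^sub>R X x) \<and> V (x + t *\<^sub>R X x) \<le> max d (V x - t * e')"
      by linarith
  qed
qed

section \<open>Deforming a set into a small sublevel set\<close>

text \<open>Iterating the uniform Euler step replaces the flow of \<open>X\<close>: the straight segments that
  the points trace lie in \<open>C\<close>, so each step is a linear homotopy, and finitely many steps
  exhaust the gap between the levels \<open>c\<close> and \<open>d\<close>.\<close>

lemma push_into_sublevel:
  fixes V h :: "'a::real_inner \<Rightarrow> real"
  assumes U: "open U"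
    and V: "\<And>x. x \<in> U \<Longrightarrow> GDERIV V x :> p x" and p: "continuous_on U p"
    and h: "\<And>x. x \<in> U \<Longrightarrow> GDERIV h x :> q x" and q: "continuous_on U q"
    and X: "continuous_on U X"
    and C: "C = {x. 0 \<le> h x}" "C \<subseteq> U"
    and comp: "compact {x \<in> C. V x \<le> c}" and dc: "d \<le> c"
    and decr: "\<And>x. x \<in> C \<Longrightarrow> d \<le> V x \<Longrightarrow> p x \<bullet> X x < 0"
    and incr: "\<And>x. x \<in> C \<Longrightarrow> h x = 0 \<Longrightarrow> 0 < q x \<bullet> X x"
    and S: "S \<subseteq> {x \<in> C. V x \<le> c}"
  shows "\<exists>g. homotopic_with_canon (\<lambda>_. True) S C id g \<and> g ` S \<subseteq> {x \<in> C. V x \<le> d}"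
proof -
  define M where "M = {x \<in> C. V x \<le> c}"
  have M: "compact M" "M \<subseteq> U" "\<And>x. x \<in> M \<Longrightarrow> 0 \<le> h x" "M \<subseteq> C"
    using comp C unfolding M_def by auto
  have "\<exists>e>0. \<forall>x\<in>M. \<forall>t\<in>{0..e}. 0 \<le> h (x + t *\<^sub>R X x) \<and> V (x + t *\<^sub>R X x) \<le> max d (V x - t * e)"
    using decr incr M by (intro euler_step_uniform[OF U V p h q X M(1-3)]) auto
  then obtain e where e: "e > 0"
    and step: "\<And>x t. x \<in> M \<Longrightarrow> t \<in> {0..e} \<Longrightarrow>
          0 \<le> h (x + t *\<^sub>R X x) \<and> V (x + t *\<^sub>R X x) \<le> max d (V x - t * e)"
    by blast
  define F where "F = (\<lambda>x. x + e *\<^sub>R X x)"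
  have contF: "continuous_on M F"
    unfolding F_def using X M(2) by (intro continuous_intros) (rule continuous_on_subset)
  have iter: "homotopic_with_canon (\<lambda>_. True) S C id (F ^^ k) \<and>
     (\<forall>x\<in>S. (F ^^ k) x \<in> M \<and> V ((F ^^ k) x) \<le> max d (c - k * e\<^sup>2))" for k
  proof (induction k)
    case 0
    have "homotopic_with_canon (\<lambda>_. True) S C id id"
      using S M(4) by (auto simp: M_def)
    then show ?case using S by (auto simp: M_def)
  next
    case (Suc k)
    let ?g = "F ^^ k"
    have gM: "?g x \<in> M" "V (?g x) \<le> max d (c - k * e\<^sup>2)" if "x \<in> S" for x
      using Suc that by auto
    have contg: "continuous_on S ?g"
      using Suc homotopic_with_imp_continuous by blast
    have contFg: "continuous_on S (F ^^ Suc k)"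
      using continuous_on_compose2[OF contF contg] gM(1) by auto
    have "closed_segment (?g x) ((F ^^ Suc k) x) \<subseteq> C" if "x \<in> S" for x
    proof
      fix y assume "y \<in> closed_segment (?g x) ((F ^^ Suc k) x)"
      then obtain s where s: "0 \<le> s" "s \<le> 1" "y = (1 - s) *\<^sub>R ?g x + s *\<^sub>R (F ^^ Suc k) x"
        unfolding in_segment by blast
      then have "y = ?g x + (s * e) *\<^sub>R X (?g x)"
        by (simp add: F_def algebra_simps)
      moreover have "s * e \<in> {0..e}" using s e by (auto simp: mult_left_le_one_le)
      ultimately show "y \<in> C" using step[OF gM(1)[OF that]] C by auto
    qed
    then have "homotopic_with_canon (\<lambda>_. True) S C ?g (F ^^ Suc k)"
      by (intro homotopic_with_linear contg contFg)
    then have "homotopic_with_canon (\<lambda>_. True) S C id (F ^^ Suc k)"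
      using Suc homotopic_with_trans by blast
    moreover have "(F ^^ Suc k) x \<in> M \<and> V ((F ^^ Suc k) x) \<le> max d (c - Suc k * e\<^sup>2)"
      if "x \<in> S" for x
    proof -
      have "0 \<le> h ((F ^^ Suc k) x)" and 1: "V ((F ^^ Suc k) x) \<le> max d (V (?g x) - e\<^sup>2)"
        using step[OF gM(1)[OF that], of e] e by (auto simp: F_def power2_eq_square)
      moreover have "V (?g x) \<le> c" "0 \<le> e\<^sup>2" using gM(1)[OF that] by (auto simp: M_def)
      moreover from this 1 dc have "V ((F ^^ Suc k) x) \<le> c" by linarith
      ultimately have "(F ^^ Suc k) x \<in> M" using C by (auto simp: M_def)
      moreover have "V (?g x) - e\<^sup>2 \<le> max d (c - Suc k * e\<^sup>2)"
      proof -
        have "c - Suc k * e\<^sup>2 = c - k * e\<^sup>2 - e\<^sup>2" by (simp add: algebra_simps)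
        then show ?thesis using gM(2)[OF that] \<open>0 \<le> e\<^sup>2\<close> by linarith
      qed
      ultimately show ?thesis using 1 by linarith
    qed
    ultimately show ?case by blast
  qed
  obtain k :: nat where "(c - d) / e\<^sup>2 \<le> k" using real_arch_simple by blast
  then have "c - k * e\<^sup>2 \<le> d" using e by (simp add: field_simps)
  then have "(F ^^ k) ` S \<subseteq> {x \<in> C. V x \<le> d}"
    using iter[of k] M(4) by fastforce
  then show ?thesis using iter[of k] by blast
qed

section \<open>Bounded complementary components as an obstruction\<close>

text \<open>A contraction of \<open>frontier K\<close> inside \<open>C\<close> avoids every point \<open>a\<close> of \<open>K\<close>, so radial projection
  from \<open>a\<close> turns it into a contraction of the Borsuk map of \<open>a\<close>. That map is essential, because
  \<open>a\<close> cannot leave the bounded set \<open>K\<close> without crossing \<open>frontier K\<close>.\<close>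

lemma inclusion_of_frontier_essential:
  fixes C :: "'a::euclidean_space set"
  assumes C: "closed C" and K: "K \<in> components (- C)" "bounded K"
  shows "\<not> homotopic_with_canon (\<lambda>_. True) (frontier K) C id (\<lambda>_. b)"
proof
  assume hom: "homotopic_with_canon (\<lambda>_. True) (frontier K) C id (\<lambda>_. b)"
  obtain a where a: "a \<in> K" using in_components_nonempty[OF K(1)] by blast
  have opK: "open K" using K C open_components by blast
  have aC: "a \<notin> C" using a in_components_subset[OF K(1)] by blast
  have aF: "a \<notin> frontier K" using a opK by (simp add: frontier_def interior_open)
  have comp: "compact (frontier K)" using K(2) by (simp add: compact_frontier_bounded)
  have "connected_component_set (- frontier K) a \<subseteq> K"
  proof (rule ccontr)
    let ?A = "connected_component_set (- frontier K) a"
    assume "\<not> ?A \<subseteq> K"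
    moreover have "a \<in> ?A" using aF by (simp add: connected_component_refl_eq)
    ultimately have "?A \<inter> K \<noteq> {}" "?A - K \<noteq> {}" using a by blast+
    then have "?A \<inter> frontier K \<noteq> {}"
      by (intro connected_Int_frontier connected_connected_component)
    then show False using connected_component_subset[of "- frontier K" a] by blast
  qed
  then have "bounded (connected_component_set (- frontier K) a)"
    using K(2) bounded_subset by blast
  moreover
  let ?B = "\<lambda>x. inverse (norm (x - a)) *\<^sub>R (x - a)"
  have "homotopic_with_canon (\<lambda>_. True) (frontier K) (sphere 0 1) (?B \<circ> id) (?B \<circ> (\<lambda>_. b))"
    using hom continuous_on_Borsuk_map[OF aC] aC
    by (intro homotopic_with_compose_continuous_left[where Y=C]) (auto simp: Borsuk_map_into_sphere)
  then have "\<exists>v. homotopic_with_canon (\<lambda>_. True) (frontier K) (sphere 0 1) ?B (\<lambda>_. v)"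
    by (auto simp: o_def)
  ultimately show False
    using Borsuk_map_essential_bounded_component[OF comp aF] by blast
qed

section \<open>Strict compatibility\<close>

lemma GDERIV_gradient:
  fixes g :: "'a::euclidean_space \<Rightarrow> real"
  assumes "g differentiable (at x)"
  shows "GDERIV g x :> gradient g x"
proof -
  obtain D where D: "(g has_derivative D) (at x)" using assms differentiable_def by blast
  then have "linear D" by (rule has_derivative_linear)
  then have "D = (\<lambda>v. v \<bullet> adjoint D 1)" by (auto simp: adjoint_works)
  then have "GDERIV g x :> adjoint D 1" using D unfolding gderiv_def by simp
  then show ?thesis using gradient_eq by metis
qed

text \<open>If Cauchy--Schwarz were an equality, the two vectors would be nonnegative multiples of
  each other, and then no \<open>w\<close> could separate them.\<close>

lemma separated_inner_less:
  fixes p q w :: "'a::real_inner"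
  assumes "p \<bullet> w < 0" "0 < q \<bullet> w"
  shows "p \<bullet> q < norm p * norm q"
proof -
  have "p \<bullet> q \<noteq> norm p * norm q"
  proof
    assume "p \<bullet> q = norm p * norm q"
    then have "norm p *\<^sub>R q = norm q *\<^sub>R p" by (simp add: norm_cauchy_schwarz_eq)
    then have "norm p * (q \<bullet> w) = norm q * (p \<bullet> w)" by (metis inner_scaleR_left)
    moreover have "norm p * (q \<bullet> w) > 0"
    proof -
      have "p \<noteq> 0" using assms(1) by auto
      then show ?thesis using assms(2) by simp
    qed
    moreover have "norm q * (p \<bullet> w) \<le> 0" using assms by (simp add: mult_nonneg_nonpos)
    ultimately show False by linarith
  qed
  then show ?thesis using norm_cauchy_schwarz[of p q] by linarith
qed

text \<open>Without \<open>s\<close>, the products of \<open>norm p *\<^sub>R q - (norm q + s) *\<^sub>R p\<close> with \<open>p\<close> and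
  \<open>q\<close> are the Cauchy--Schwarz gap \<open>norm p * norm q - p \<bullet> q\<close> up to a factor \<open>- norm p\<close> and
  \<open>norm q\<close>. The term \<open>s\<close>, which will be the value of \<open>h\<close>, makes the first product strictly negative
  where \<open>q\<close> vanishes or is parallel to \<open>p\<close>, and disappears on the boundary, the only place where
  the sign of the second one matters.\<close>

lemma steering_decreases:
  fixes p q :: "'a::real_inner" and s :: real
  assumes "p \<noteq> 0" "0 \<le> s" "s = 0 \<Longrightarrow> p \<bullet> q < norm p * norm q"
  shows "p \<bullet> (norm p *\<^sub>R q - (norm q + s) *\<^sub>R p) < 0"
proof -
  have eq: "p \<bullet> (norm p *\<^sub>R q - (norm q + s) *\<^sub>R p)
      = norm p * (p \<bullet> q - norm p * norm q) - s * (norm p)\<^sup>2"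
    by (simp add: inner_diff_right dot_square_norm power2_eq_square algebra_simps)
  show ?thesis
  proof (cases "s = 0")
    case True
    then show ?thesis unfolding eq using assms by (simp add: mult_pos_neg)
  next
    case False
    have "norm p * (p \<bullet> q - norm p * norm q) \<le> 0"
      using norm_cauchy_schwarz[of p q] by (simp add: mult_nonneg_nonpos)
    moreover have "s * (norm p)\<^sup>2 > 0" using False assms by simp
    ultimately show ?thesis unfolding eq by linarith
  qed
qed

lemma steering_increases:
  fixes p q :: "'a::real_inner"
  assumes "q \<noteq> 0" "p \<bullet> q < norm p * norm q"
  shows "0 < q \<bullet> (norm p *\<^sub>R q - norm q *\<^sub>R p)"
proof -
  have "q \<bullet> (norm p *\<^sub>R q - norm q *\<^sub>R p) = norm q * (norm p * norm q - p \<bullet> q)"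
    by (simp add: inner_diff_right dot_square_norm power2_eq_square inner_commute algebra_simps)
  then show ?thesis using assms by simp
qed

lemma small_sublevel_in_ball:
  fixes V :: "'a::real_normed_vector \<Rightarrow> real"
  assumes proper: "proper_in V U" and pos: "positive_definite_on V U"
    and cont: "continuous_on U V" and r: "0 < r"
  obtains d where "0 < d" "{x \<in> U. V x \<le> d} \<subseteq> ball 0 r"
proof -
  let ?A = "{x \<in> U. V x \<le> 1} - ball 0 r"
  have A: "compact ?A" using proper by (simp add: proper_in_def compact_diff)
  show thesis
  proof (cases "?A = {}")
    case True
    then show thesis using that[of 1] by auto
  next
    case False
    have "continuous_on ?A V" using cont by (rule continuous_on_subset) auto
    then obtain z where z: "z \<in> ?A" "\<And>y. y \<in> ?A \<Longrightarrow> V z \<le> V y"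
      using continuous_attains_inf[OF A False] by blast
    have "V z > 0" using z(1) pos r unfolding positive_definite_on_def by force
    moreover have "x \<in> ball 0 r" if "x \<in> U" "V x \<le> min 1 (V z / 2)" for x
    proof (rule ccontr)
      assume "x \<notin> ball 0 r"
      then have "V z \<le> V x" using that by (intro z(2)) auto
      then show False using that \<open>V z > 0\<close> by linarith
    qed
    ultimately show thesis by (intro that[of "min 1 (V z / 2)"]) auto
  qed
qed

theorem propositionV1:
  fixes f :: "(real^'n) \<times> (real^'m) \<Rightarrow> real^'n"
    and C :: "(real^'n) set"
  assumes "locally_lipschitz_on f UNIV"
    and "\<exists>h0. zero_superlevel_set h0 C"
    and "0 \<in> interior C"
    and "\<exists>K \<in> components (- C). bounded K"
  shows "\<not> (\<exists>\<Gamma> V h. strictly_compatible f \<Gamma> C V h)"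
proof
  assume "\<exists>\<Gamma> V h. strictly_compatible f \<Gamma> C V h"
  then obtain \<Gamma> V h W \<alpha> where \<Gamma>: "open \<Gamma>" and clC: "closed C" and C\<Gamma>: "C \<subseteq> \<Gamma>"
    and clf: "clf_with f \<Gamma> V W" and cbf: "cbf_with f C h \<alpha>"
    and strict: "\<And>x. x \<in> C - {0} \<Longrightarrow> \<exists>u. gradient V x \<bullet> f (x, u) < - W x \<and>
                        gradient h x \<bullet> f (x, u) + \<alpha> (h x) > 0"
    unfolding strictly_compatible_def by blast
  from clf have proper: "proper_in V \<Gamma>" and posV: "positive_definite_on V \<Gamma>"
    and posW: "positive_definite_on W \<Gamma>" and cV: "continuously_differentiable_on V \<Gamma>"
    unfolding clf_with_def by auto
  from cbf have ch: "continuously_differentiable_on h UNIV" and C: "C = {x. 0 \<le> h x}"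
    and intC: "interior C = {x. h x > 0}" and \<alpha>0: "\<alpha> 0 = 0"
    unfolding cbf_with_def zero_superlevel_set_def extended_class_K_inf_def by auto
  define p where "p = gradient V"
  define q where "q = gradient h"
  have V: "\<And>x. x \<in> \<Gamma> \<Longrightarrow> GDERIV V x :> p x" and contp: "continuous_on \<Gamma> p"
    using cV GDERIV_gradient unfolding continuously_differentiable_on_def p_def by auto
  have h: "\<And>x. x \<in> \<Gamma> \<Longrightarrow> GDERIV h x :> q x" and contq: "continuous_on \<Gamma> q"
    using ch GDERIV_gradient continuous_on_subset
    unfolding continuously_differentiable_on_def q_def by blast+
  have contV: "continuous_on \<Gamma> V" and conth: "continuous_on \<Gamma> h"
    using V h \<Gamma> unfolding gderiv_def
    by (meson continuous_at_imp_continuous_on has_derivative_continuous)+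
  have nz: "p x \<noteq> 0" if "x \<in> C" "x \<noteq> 0" for x
  proof -
    have "W x > 0" using posW that C\<Gamma> unfolding positive_definite_on_def by blast
    then show ?thesis using strict[of x] that unfolding p_def by force
  qed
  have bd: "p x \<bullet> q x < norm (p x) * norm (q x) \<and> q x \<noteq> 0"
    if x: "x \<in> C" "h x = 0" for x
  proof -
    have x0: "x \<noteq> 0" using that assms(3) intC by auto
    then have "W x > 0" using posW that C\<Gamma> unfolding positive_definite_on_def by blast
    then obtain u where "p x \<bullet> f (x, u) < 0" "0 < q x \<bullet> f (x, u)"
      using strict[of x] x x0 \<alpha>0 unfolding p_def q_def by force
    then show ?thesis using separated_inner_less by force
  qed
  define X where "X = (\<lambda>x. norm (p x) *\<^sub>R q x - (norm (q x) + h x) *\<^sub>R p x)"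
  have contX: "continuous_on \<Gamma> X"
    unfolding X_def by (intro continuous_intros contp contq conth)

  obtain K where K: "K \<in> components (- C)" "bounded K" using assms(4) by blast
  have FC: "frontier K \<subseteq> C"
    by (rule frontier_of_components_closed_complement[OF clC K(1)])
  obtain r where r: "0 < r" "ball 0 r \<subseteq> C"
    using assms(3) unfolding mem_interior by blast
  obtain d where d: "0 < d" "{x \<in> \<Gamma>. V x \<le> d} \<subseteq> ball 0 r"
    using small_sublevel_in_ball[OF proper posV contV r(1)] .
  have "compact (V ` frontier K)"
    using contV FC C\<Gamma> K(2)
    by (intro compact_continuous_image continuous_on_subset[OF contV])
       (auto simp: compact_frontier_bounded)
  then obtain B where B: "\<And>x. x \<in> frontier K \<Longrightarrow> V x \<le> B"
    using compact_imp_bounded bounded_has_Sup(1) by (metis empty_iff image_eqI)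
  define c where "c = max d B"
  have "compact ({x \<in> \<Gamma>. V x \<le> c} \<inter> C)"
    using proper clC d(1) unfolding proper_in_def c_def by (intro compact_Int_closed) auto
  moreover have "{x \<in> \<Gamma>. V x \<le> c} \<inter> C = {x \<in> C. V x \<le> c}" using C\<Gamma> by auto
  ultimately have comp: "compact {x \<in> C. V x \<le> c}" by simp

  have decr: "p x \<bullet> X x < 0" if "x \<in> C" "d \<le> V x" for x
  proof -
    have "x \<noteq> 0" using that d(1) posV unfolding positive_definite_on_def by auto
    then show ?thesis
      unfolding X_def using that nz bd C by (intro steering_decreases) auto
  qed
  have incr: "0 < q x \<bullet> X x" if "x \<in> C" "h x = 0" for x
    unfolding X_def using steering_increases bd[OF that] that(2) by auto
  obtain g where g: "homotopic_with_canon (\<lambda>_. True) (frontier K) C id g"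
      "g ` frontier K \<subseteq> {x \<in> C. V x \<le> d}"
  proof -
    have "frontier K \<subseteq> {x \<in> C. V x \<le> c}" using FC B by (auto simp: c_def le_max_iff_disj)
    moreover have "d \<le> c" by (simp add: c_def)
    ultimately show thesis
      using push_into_sublevel[OF \<Gamma> V contp h contq contX C C\<Gamma> comp _ decr incr] that by blast
  qed
  have "homotopic_with_canon (\<lambda>_. True) (frontier K) C g (\<lambda>_. 0)"
  proof (rule homotopic_with_linear)
    show "continuous_on (frontier K) g" using homotopic_with_imp_continuous[OF g(1)] by blast
    fix x assume "x \<in> frontier K"
    then have "g x \<in> ball 0 r" using g(2) d(2) C\<Gamma> by blast
    then have "closed_segment (g x) 0 \<subseteq> ball 0 r"
      using r(1) by (intro closed_segment_subset) auto
    then show "closed_segment (g x) 0 \<subseteq> C" using r(2) by blast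
  qed auto
  then have "homotopic_with_canon (\<lambda>_. True) (frontier K) C id (\<lambda>_. 0)"
    using g(1) homotopic_with_trans by blast
  then show False using inclusion_of_frontier_essential[OF clC K] by blast
qed

end
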